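(* Let $f:\mathcal{X}\times\Theta\to\mathbb{R}_{\ge 0}$ be Lipschitz in $\theta$ with constant $L$, i.e. $|f(x,\theta)-f(x,\theta')|\le L\|\theta-\theta'\|$ for all $x\in\mathcal{X}$ and $\theta,\theta'\in\Theta$, and let $d$ be a metric on $\mathcal{X}$. Let $t,S\in\mathbb{N}$ with $t,S\ge 1$, let $x_{t-1}\in\mathcal{X}$ be a given initial decision, let $\theta_t,\dots,\theta_{t+S-1}\in\Theta$ be the true parameters, and let $\theta^{(t)}_t,\dots,\theta^{(t)}_{t+S-1}\in\Theta$ be the predictions made at time $t$, with $\|\theta_s-\theta^{(t)}_s\|\le \epsilon^{(t)}_s$ for all $s\in\{t,\dots,t+S-1\}$. Let $(x_s)_{s=t}^{t+S-1}$ be a minimizer of the planning problem with predicted parameters, $$\min_{y_t,\dots,y_{t+S-1}\in\mathcal{X}}\ \sum_{s=t}^{t+S-1} f(y_s,\theta^{(t)}_s)+d(y_s,y_{s-1}),\qquad y_{t-1}=x_{t-1},$$ and let $(x'_s)_{s=t}^{t+S-1}$ be a minimizer of the planning problem with true parameters, $$\min_{y_t,\dots,y_{t+S-1}\in\mathcal{X}}\ \sum_{s=t}^{t+S-1} f(y_s,\theta_s)+d(y_s,y_{s-1}),\qquad y_{t-1}=x_{t-1},$$ with $x'_{t-1}=x_{t-1}$. Then the regret $$\mathrm{Reg}_t^{t+S-1}(x_{t-1})=\sum_{s=t}^{t+S-1}\bigl(f(x_s,\theta_s)+d(x_s,x_{s-1})\bigr)-\sum_{s=t}^{t+S-1}\bigl(f(x'_s,\theta_s)+d(x'_s,x'_{s-1})\bigr)$$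 satisfies $$\mathrm{Reg}_t^{t+S-1}(x_{t-1})\le 2L\sum_{s=t}^{t+S-1}\epsilon^{(t)}_s .$$
   Context: $\mathcal{X}$ is the set of feasible (combinatorial) decisions, $\Theta$ is a set of parameters contained in a normed space with norm $\|\cdot\|$, $f$ is the cost function and $d$ is the switching cost. The numbers $\epsilon^{(t)}_s\ge 0$ are the predictive uncertainties. The minimizers named in the statement are assumed to exist. *)

theory Defs
  imports "HOL-Analysis.Analysis"
begin

text \<open>
  A decision sequence is a function on all of \<open>nat\<close>, of which only the values at the times
  \<open>t - 1, \<dots>, t + S - 1\<close> matter. The value at time \<open>t - 1\<close> is the given initial decision, so that
  \<open>d (y t) (y (t - 1))\<close> is the switching cost from the initial decision. All uses have \<open>t \<ge> 1\<close>,
  so the subtractions on \<open>nat\<close> do not truncate.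
\<close>

definition plan_cost ::
  "('x \<Rightarrow> 'p \<Rightarrow> real) \<Rightarrow> ('x \<Rightarrow> 'x \<Rightarrow> real) \<Rightarrow> nat \<Rightarrow> nat \<Rightarrow> (nat \<Rightarrow> 'p) \<Rightarrow> (nat \<Rightarrow> 'x) \<Rightarrow> real" where
  "plan_cost f d t S \<theta> y = (\<Sum>s = t..t + S - 1. f (y s) (\<theta> s) + d (y s) (y (s - 1)))"

definition feasible_plan :: "'x set \<Rightarrow> nat \<Rightarrow> nat \<Rightarrow> 'x \<Rightarrow> (nat \<Rightarrow> 'x) \<Rightarrow> bool" where
  "feasible_plan X t S x0 y \<longleftrightarrow> y (t - 1) = x0 \<and> (\<forall>s\<in>{t..t + S - 1}. y s \<in> X)"

definition plan_minimizer ::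
  "'x set \<Rightarrow> ('x \<Rightarrow> 'p \<Rightarrow> real) \<Rightarrow> ('x \<Rightarrow> 'x \<Rightarrow> real) \<Rightarrow> nat \<Rightarrow> nat \<Rightarrow> (nat \<Rightarrow> 'p) \<Rightarrow> 'x
    \<Rightarrow> (nat \<Rightarrow> 'x) \<Rightarrow> bool" where
  "plan_minimizer X f d t S \<theta> x0 y \<longleftrightarrow>
     is_arg_min (plan_cost f d t S \<theta>) (feasible_plan X t S x0) y"

text \<open>
  The regret of the plan \<open>x\<close> against the comparison plan \<open>x'\<close>; both are evaluated with the
  parameters \<open>\<theta>\<close>, which are the true ones.
\<close>

definition regret ::
  "('x \<Rightarrow> 'p \<Rightarrow> real) \<Rightarrow> ('x \<Rightarrow> 'x \<Rightarrow> real) \<Rightarrow> nat \<Rightarrow> nat \<Rightarrow> (nat \<Rightarrow> 'p)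
    \<Rightarrow> (nat \<Rightarrow> 'x) \<Rightarrow> (nat \<Rightarrow> 'x) \<Rightarrow> real" where
  "regret f d t S \<theta> x x' = plan_cost f d t S \<theta> x - plan_cost f d t S \<theta> x'"

end

theory Submission
  imports Defs
begin

text \<open>Replacing the true parameters by the predicted ones moves the cost of any fixed feasible
  plan by at most E, where E is \<open>L\<close> times the sum of the \<open>\<epsilon> s\<close>;
  this is \<open>plan_cost_perturbation\<close>. Write C and C' for the true and the predicted cost.
  Since \<open>x\<close> minimizes C', C(x) \<le> C'(x) + E \<le> C'(x') + E \<le> C(x') +
  2E.\<close>

lemma plan_cost_perturbation:
  fixes \<theta> \<theta>' :: "nat \<Rightarrow> 'p::real_normed_vector"
  assumes "\<And>z. z \<in> X \<Longrightarrow> L-lipschitz_on \<Theta> (f z)"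
    and "\<And>s. s \<in> {t..t + S - 1} \<Longrightarrow> \<theta> s \<in> \<Theta>"
    and "\<And>s. s \<in> {t..t + S - 1} \<Longrightarrow> \<theta>' s \<in> \<Theta>"
    and "\<And>s. s \<in> {t..t + S - 1} \<Longrightarrow> norm (\<theta> s - \<theta>' s) \<le> \<epsilon> s"
    and "feasible_plan X t S x0 y"
  shows "\<bar>plan_cost f d t S \<theta> y - plan_cost f d t S \<theta>' y\<bar> \<le> L * (\<Sum>s = t..t + S - 1. \<epsilon> s)"
proof -
  have "\<bar>f (y s) (\<theta> s) - f (y s) (\<theta>' s)\<bar> \<le> L * \<epsilon> s" if s: "s \<in> {t..t + S - 1}" for s
  proof -
    have lip: "L-lipschitz_on \<Theta> (f (y s))"
      using assms(1,5) s by (auto simp: feasible_plan_def)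
    have "\<bar>f (y s) (\<theta> s) - f (y s) (\<theta>' s)\<bar> \<le> L * norm (\<theta> s - \<theta>' s)"
      using lipschitz_onD[OF lip assms(2,3)[OF s]] by (simp add: dist_norm)
    \<comment> \<open>Monotonicity needs 0 \<le> \<open>L\<close>, which is part of
      \<open>lipschitz_on\<close>.\<close>
    also have "\<dots> \<le> L * \<epsilon> s"
      using assms(4)[OF s] lipschitz_on_nonneg[OF lip] by (rule mult_left_mono)
    finally show ?thesis .
  qed
  then have "\<bar>\<Sum>s = t..t + S - 1. f (y s) (\<theta> s) - f (y s) (\<theta>' s)\<bar> \<le> (\<Sum>s = t..t + S - 1. L * \<epsilon> s)"
    by (intro order_trans[OF sum_abs] sum_mono)
  \<comment> \<open>The switching costs do not depend on the parameters and cancel in the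
    difference, leaving only the terms in \<open>f\<close>.\<close>
  then show ?thesis
    by (simp add: plan_cost_def sum_distrib_left flip: sum_subtractf)
qed

theorem theorem3p4:
  fixes X :: "'x set" and \<Theta> :: "'p::real_normed_vector set"
    and f :: "'x \<Rightarrow> 'p \<Rightarrow> real" and d :: "'x \<Rightarrow> 'x \<Rightarrow> real"
    and L :: real and t S :: nat and x0 :: 'x
    and \<theta> \<theta>pred :: "nat \<Rightarrow> 'p" and \<epsilon> :: "nat \<Rightarrow> real"
    and x x' :: "nat \<Rightarrow> 'x"
  assumes f_nonneg: "\<And>y p. y \<in> X \<Longrightarrow> p \<in> \<Theta> \<Longrightarrow> 0 \<le> f y p"
    and f_lipschitz: "\<And>y. y \<in> X \<Longrightarrow> L-lipschitz_on \<Theta> (f y)"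
    and d_metric: "Metric_space X d"
    and t_pos: "t \<ge> 1" and S_pos: "S \<ge> 1"
    and x0_mem: "x0 \<in> X"
    and true_mem: "\<And>s. s \<in> {t..t + S - 1} \<Longrightarrow> \<theta> s \<in> \<Theta>"
    and pred_mem: "\<And>s. s \<in> {t..t + S - 1} \<Longrightarrow> \<theta>pred s \<in> \<Theta>"
    and eps_nonneg: "\<And>s. s \<in> {t..t + S - 1} \<Longrightarrow> 0 \<le> \<epsilon> s"
    and pred_error: "\<And>s. s \<in> {t..t + S - 1} \<Longrightarrow> norm (\<theta> s - \<theta>pred s) \<le> \<epsilon> s"
    and x_min: "plan_minimizer X f d t S \<theta>pred x0 x"
    and x'_min: "plan_minimizer X f d t S \<theta> x0 x'"
  shows "regret f d t S \<theta> x x' \<le> 2 * L * (\<Sum>s = t..t + S - 1. \<epsilon> s)"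
proof -
  have x: "feasible_plan X t S x0 x" and x': "feasible_plan X t S x0 x'"
    using x_min x'_min by (simp_all add: plan_minimizer_def is_arg_min_def)
  \<comment> \<open>Feasibility does not involve the parameters, so \<open>x'\<close> also competes
    in the predicted problem.\<close>
  have opt: "plan_cost f d t S \<theta>pred x \<le> plan_cost f d t S \<theta>pred x'"
    using x_min x' by (auto simp: plan_minimizer_def is_arg_min_linorder)
  have "\<bar>plan_cost f d t S \<theta> y - plan_cost f d t S \<theta>pred y\<bar> \<le> L * (\<Sum>s = t..t + S - 1. \<epsilon> s)"
    if "feasible_plan X t S x0 y" for y
    using f_lipschitz true_mem pred_mem pred_error that by (rule plan_cost_perturbation)
  \<comment> \<open>The factor 2 arises because the perturbation bound is paid once for
    \<open>x\<close> and once for \<open>x'\<close>.\<close>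
  from this[OF x] this[OF x'] opt show ?thesis
    unfolding regret_def by linarith
qed

end
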